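(* Given $f\in H^2$ and an integer $n\geqslant0$, the following identities hold: $$\sum_{m=-\infty}^{+\infty}|f(2m+in)|^2=\sum_{m=-\infty}^{+\infty}|f(2m+1+in)|^2=\frac12\sum_{m=-\infty}^{+\infty}|f(m+in)|^2.$$ In particular, for $n=0$, $$\sum_{m=-\infty}^{+\infty}|f(2m)|^2=\sum_{m=-\infty}^{+\infty}|f(2m+1)|^2=\frac12\|f\|_{H^2}^2,$$ and the sets $\Lambda_0^{\mathrm{even}}=\{2m: m\in\mathbb Z\}$ and $\Lambda_0^{\mathrm{odd}}=\{2m+1: m\in\mathbb Z\}$ are sampling sets for $H^2$.
   Context: Lattice points $(m,n)\in\mathbb Z^2$ are identified with $m+in\in\mathbb C$. Let $\mathbb Z^2_+=\{m+in: m,n\in\mathbb Z,\ n\geqslant 0\}$. A function $f:\mathbb Z^2_+\to\mathbb C$ is discrete holomorphic, written $f\in\operatorname{Hol}(\mathbb Z^2_+)$, if $f(z)+i f(z+1)-f(z+1+i)-i f(z+i)=0$ for every $z\in\mathbb Z^2_+$. $H^2=H^2(\mathbb Z^2_+)=\{f\in\operatorname{Hol}(\mathbb Z^2_+): \|f\|_{H^2}:=\sup_{n\geqslant 0}\|f(\cdot+in)\|_{\ell^2(\mathbb Z)}<\infty\}$. A set $\Lambda\subseteq\mathbb Z^2_+$ is a sampling set for $H^2$ if there are constants $0<c\leqslant c'<\infty$ with $c\|f\|_{H^2}^2\leqslant\sum_{\lambda\in\Lambda}|f(\lambda)|^2\leqslant c'\|f\|_{H^2}^2$ for every $f\in H^2$.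 *)

theory Defs
  imports "HOL-Analysis.Analysis"
begin

definition Z2_plus :: "complex set" where
  "Z2_plus = {of_int m + \<i> * of_int n | m n. n \<ge> 0}"

text \<open>
  A function on the lattice half-plane \<^term>\<open>Z2_plus\<close> is represented by a total function on the
  complex numbers. All notions below only look at its values on \<^term>\<open>Z2_plus\<close>.
\<close>

definition Hol :: "(complex \<Rightarrow> complex) set" where
  "Hol = {f. \<forall>z\<in>Z2_plus. f z + \<i> * f (z + 1) - f (z + 1 + \<i>) - \<i> * f (z + \<i>) = 0}"

definition in_l2 :: "(int \<Rightarrow> complex) \<Rightarrow> bool" where
  "in_l2 g \<longleftrightarrow> (\<lambda>m. (cmod (g m))\<^sup>2) summable_on UNIV"

definition l2_norm :: "(int \<Rightarrow> complex) \<Rightarrow> real" where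
  "l2_norm g = sqrt (\<Sum>\<^sub>\<infinity>m. (cmod (g m))\<^sup>2)"

definition row :: "(complex \<Rightarrow> complex) \<Rightarrow> nat \<Rightarrow> int \<Rightarrow> complex" where
  "row f n = (\<lambda>m. f (of_int m + \<i> * of_nat n))"

text \<open>
  Finiteness of the supremum of the norms of the rows means that each row is square summable and
  that the real-valued norms of the rows are bounded.
\<close>

definition H2 :: "(complex \<Rightarrow> complex) set" where
  "H2 = {f \<in> Hol. (\<forall>n. in_l2 (row f n)) \<and> bdd_above (range (\<lambda>n. l2_norm (row f n)))}"

definition H2_norm :: "(complex \<Rightarrow> complex) \<Rightarrow> real" where
  "H2_norm f = (SUP n. l2_norm (row f n))"

definition sampling_set :: "complex set \<Rightarrow> bool" where
  "sampling_set \<Lambda> \<longleftrightarrow> \<Lambda> \<subseteq> Z2_plus \<and>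
     (\<exists>c c'::real. 0 < c \<and> c \<le> c' \<and>
        (\<forall>f\<in>H2. (\<lambda>z. (cmod (f z))\<^sup>2) summable_on \<Lambda> \<and>
           c * (H2_norm f)\<^sup>2 \<le> (\<Sum>\<^sub>\<infinity>z\<in>\<Lambda>. (cmod (f z))\<^sup>2) \<and>
           (\<Sum>\<^sub>\<infinity>z\<in>\<Lambda>. (cmod (f z))\<^sup>2) \<le> c' * (H2_norm f)\<^sup>2))"

definition Lambda0_even :: "complex set" where
  "Lambda0_even = {of_int (2 * m) | m. True}"

definition Lambda0_odd :: "complex set" where
  "Lambda0_odd = {of_int (2 * m + 1) | m. True}"

end

theory Submission
  imports Defs
begin

text \<open>
  Write \<open>r n\<close> for the rows of \<open>f\<close>, \<open>S\<close> for the shift and \<open>M\<close> for multiplication by \<open>(-1)^m\<close>. The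
  equation reads \<open>(1 + \<i>S) (r n) = (S + \<i>) (r (n + 1))\<close>; on the Fourier side it is multiplication by the
  real function \<open>q = cos t / (1 + sin t)\<close>, and \<open>M\<close>, the translation by \<open>\<pi>\<close>, turns \<open>q\<close> into \<open>-1/q\<close>.
  Without Fourier analysis this gives two identities for inner products:
  \<open>\<langle>r (n + 1), r m\<rangle> = \<langle>r n, r (m + 1)\<rangle>\<close> and
  \<open>\<langle>S^k (r (n + 1)), M (r (m + 1))\<rangle> = - \<langle>S^k (r n), M (r m)\<rangle>\<close>.

  By the first one, \<open>\<parallel>r (n + 2) - r n\<parallel>\<^sup>2\<close> is the second difference of \<open>\<parallel>r n\<parallel>\<^sup>2\<close>. A bounded convex
  sequence decreases, so the norm of \<open>f\<close> is that of \<open>r 0\<close>, and \<open>r (n + 2) - r n \<rightarrow> 0\<close>. By the second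
  one, \<open>\<langle>S^k (r (n + 2) - r n), M (r n)\<rangle>\<close> does not depend on \<open>n\<close> up to sign, hence vanishes. Together
  with the equation this makes \<open>\<langle>S^k (r n), M (r n)\<rangle>\<close> 2-periodic in \<open>k\<close>; since it tends to 0, it
  vanishes at \<open>k = 0\<close>, which says that even and odd sites carry the same energy.
\<close>

text \<open>The inner product of \<open>S^k a\<close> with \<open>b\<close>. Keeping the lag
  \<open>k\<close> free turns the row equation into a recurrence in \<open>k\<close>.\<close>

definition corr :: "(int \<Rightarrow> complex) \<Rightarrow> (int \<Rightarrow> complex) \<Rightarrow> int \<Rightarrow> complex" where
  "corr a b k = (\<Sum>\<^sub>\<infinity>m. a (m + k) * cnj (b m))"

text \<open>The operator \<open>M\<close> of the overview.\<close>

definition alt :: "(int \<Rightarrow> complex) \<Rightarrow> int \<Rightarrow> complex" where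
  "alt a m = (if even m then a m else - a m)"

text \<open>A relation rather than a map: \<open>a\<close> fixes \<open>a'\<close> only up to
  solutions of \<open>x (m + 1) = - \<i> * x m\<close>, which have constant modulus.\<close>

definition step :: "(int \<Rightarrow> complex) \<Rightarrow> (int \<Rightarrow> complex) \<Rightarrow> bool" where
  "step a a' \<longleftrightarrow> (\<forall>m. a m + \<i> * a (m + 1) = a' (m + 1) + \<i> * a' m)"

section \<open>Square-summable sequences and Cauchy-Schwarz\<close>

lemma l2_norm_nonneg [simp]: "0 \<le> l2_norm a"
  by (simp add: l2_norm_def infsum_nonneg)

lemma l2_norm_power2: "(l2_norm a)\<^sup>2 = (\<Sum>\<^sub>\<infinity>m. (cmod (a m))\<^sup>2)"
  by (simp add: l2_norm_def infsum_nonneg)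

lemma bij_add_int: "bij (\<lambda>m::int. m + k)"
  by (rule bij_betwI[where g = "\<lambda>m. m - k"]) auto

lemma in_l2_shift: "in_l2 a \<Longrightarrow> in_l2 (\<lambda>m. a (m + k))"
  unfolding in_l2_def
  using summable_on_reindex_bij_betw[OF bij_add_int, of "\<lambda>m. (cmod (a m))\<^sup>2" k] by simp

lemma l2_norm_shift: "l2_norm (\<lambda>m. a (m + k)) = l2_norm a"
  unfolding l2_norm_def
  using infsum_reindex_bij_betw[OF bij_add_int, of "\<lambda>m. (cmod (a m))\<^sup>2" k] by simp

lemma norm_alt [simp]: "cmod (alt a m) = cmod (a m)"
  by (simp add: alt_def)

lemma in_l2_alt [simp]: "in_l2 (alt a) \<longleftrightarrow> in_l2 a"
  by (simp add: in_l2_def)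

lemma l2_norm_alt [simp]: "l2_norm (alt a) = l2_norm a"
  by (simp add: l2_norm_def)

lemma in_l2_uminus: "in_l2 a \<Longrightarrow> in_l2 (\<lambda>m. - a m)"
  by (simp add: in_l2_def)

lemma in_l2_diff:
  assumes "in_l2 a" "in_l2 b"
  shows "in_l2 (\<lambda>m. a m - b m)"
proof -
  have "(\<lambda>m. 2 * (cmod (a m))\<^sup>2 + 2 * (cmod (b m))\<^sup>2) summable_on UNIV"
    using assms unfolding in_l2_def by (intro summable_on_add summable_on_cmult_right)
  moreover have "(cmod (a m - b m))\<^sup>2 \<le> 2 * (cmod (a m))\<^sup>2 + 2 * (cmod (b m))\<^sup>2" for m
  proof -
    have "(cmod (a m - b m))\<^sup>2 \<le> (cmod (a m) + cmod (b m))\<^sup>2"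
      by (intro power_mono norm_triangle_ineq4) simp
    also have "\<dots> \<le> 2 * (cmod (a m))\<^sup>2 + 2 * (cmod (b m))\<^sup>2"
      using sum_squares_bound[of "cmod (a m)" "cmod (b m)"] by (simp add: power2_sum)
    finally show ?thesis .
  qed
  ultimately show ?thesis
    unfolding in_l2_def by (rule summable_on_comparison_test) auto
qed

lemma l2_sum_le:
  assumes "in_l2 a" "finite F"
  shows "(\<Sum>m\<in>F. (cmod (a m))\<^sup>2) \<le> (l2_norm a)\<^sup>2"
  unfolding l2_norm_power2 using assms
  by (intro finite_sum_le_infsum) (auto simp: in_l2_def)

lemma cauchy_schwarz_finite:
  assumes "(\<Sum>m\<in>F. (cmod (a m))\<^sup>2) \<le> A\<^sup>2" "(\<Sum>m\<in>F. (cmod (b m))\<^sup>2) \<le> B\<^sup>2" "0 \<le> A" "0 \<le> B"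
  shows "(\<Sum>m\<in>F. cmod (a m * cnj (b m))) \<le> A * B"
proof -
  have "(\<Sum>m\<in>F. cmod (a m) * cmod (b m))\<^sup>2
      \<le> (\<Sum>m\<in>F. (cmod (a m))\<^sup>2) * (\<Sum>m\<in>F. (cmod (b m))\<^sup>2)"
    by (rule Cauchy_Schwarz_ineq_sum)
  also have "\<dots> \<le> A\<^sup>2 * B\<^sup>2"
    using assms(1,2) by (intro mult_mono sum_nonneg) simp_all
  finally have "(\<Sum>m\<in>F. cmod (a m) * cmod (b m))\<^sup>2 \<le> (A * B)\<^sup>2"
    by (simp add: power_mult_distrib)
  then have "(\<Sum>m\<in>F. cmod (a m) * cmod (b m)) \<le> A * B"
    by (rule power2_le_imp_le) (simp add: assms)
  then show ?thesis
    by (simp add: norm_mult)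
qed

lemma abs_summable_l2_mult:
  assumes "in_l2 a" "in_l2 b"
  shows "(\<lambda>m. cmod (a m * cnj (b m))) summable_on UNIV"
proof (rule nonneg_bdd_above_summable_on)
  show "bdd_above (sum (\<lambda>m. cmod (a m * cnj (b m))) ` {F. F \<subseteq> UNIV \<and> finite F})"
    using assms by (auto intro!: bdd_aboveI2[where M = "l2_norm a * l2_norm b"]
        cauchy_schwarz_finite l2_sum_le)
qed auto

section \<open>Correlations: bounds, linearity, decay in the lag\<close>

lemma corr_summable:
  assumes "in_l2 a" "in_l2 b"
  shows "(\<lambda>m. a (m + k) * cnj (b m)) summable_on UNIV"
  using abs_summable_summable[OF abs_summable_l2_mult[OF in_l2_shift[OF assms(1)] assms(2)]] .

lemma norm_corr_le:
  assumes "in_l2 a" "in_l2 b"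
  shows "cmod (corr a b k) \<le> l2_norm a * l2_norm b"
proof -
  have abs: "(\<lambda>m. cmod (a (m + k) * cnj (b m))) summable_on UNIV"
    by (intro abs_summable_l2_mult in_l2_shift assms)
  have "cmod (corr a b k) \<le> (\<Sum>\<^sub>\<infinity>m. cmod (a (m + k) * cnj (b m)))"
    unfolding corr_def by (rule norm_infsum_bound[OF abs])
  also have "\<dots> \<le> l2_norm a * l2_norm b"
  proof (rule infsum_le_finite_sums[OF abs])
    fix F :: "int set" assume "finite F"
    then show "(\<Sum>m\<in>F. cmod (a (m + k) * cnj (b m))) \<le> l2_norm a * l2_norm b"
      using l2_sum_le[OF in_l2_shift[OF assms(1)], of F k] l2_sum_le[OF assms(2), of F]
      by (intro cauchy_schwarz_finite) (auto simp: l2_norm_shift)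
  qed
  finally show ?thesis .
qed

lemma infsum_of_real:
  "f summable_on A \<Longrightarrow> (\<Sum>\<^sub>\<infinity>x\<in>A. complex_of_real (f x)) = of_real (infsum f A)"
  by (intro infsumI) (simp add: has_sum_of_real_iff)

lemma corr_self_0:
  assumes "in_l2 a"
  shows "corr a a 0 = of_real ((l2_norm a)\<^sup>2)"
proof -
  have "corr a a 0 = (\<Sum>\<^sub>\<infinity>m. complex_of_real ((cmod (a m))\<^sup>2))"
    unfolding corr_def complex_norm_square by simp
  also have "\<dots> = of_real ((l2_norm a)\<^sup>2)"
    using assms unfolding l2_norm_power2 in_l2_def by (rule infsum_of_real)
  finally show ?thesis .
qed

lemma infsum_diff:
  fixes f g :: "'a \<Rightarrow> 'b::real_normed_vector"
  assumes "f summable_on A" "g summable_on A"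
  shows "(\<Sum>\<^sub>\<infinity>x\<in>A. f x - g x) = infsum f A - infsum g A"
  using infsum_add[OF assms(1), of "\<lambda>x. - g x"] assms(2)
  by (simp add: infsum_uminus summable_on_uminus)

lemma corr_diff_left:
  assumes "in_l2 a" "in_l2 b" "in_l2 c"
  shows "corr (\<lambda>m. a m - b m) c k = corr a c k - corr b c k"
  unfolding corr_def using corr_summable[OF assms(1,3), of k] corr_summable[OF assms(2,3), of k]
  by (simp add: left_diff_distrib infsum_diff)

lemma corr_diff_right:
  assumes "in_l2 a" "in_l2 b" "in_l2 c"
  shows "corr c (\<lambda>m. a m - b m) k = corr c a k - corr c b k"
  unfolding corr_def using corr_summable[OF assms(3,1), of k] corr_summable[OF assms(3,2), of k]
  by (simp add: right_diff_distrib infsum_diff)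

lemma corr_uminus_right: "corr a (\<lambda>m. - b m) k = - corr a b k"
  by (simp add: corr_def infsum_uminus)

lemma in_l2_tendsto_0:
  assumes "in_l2 a"
  shows "(\<lambda>k. a (m + int k)) \<longlonglongrightarrow> 0"
proof -
  have inj: "inj (\<lambda>k. m + int k)"
    by (auto intro: injI)
  have "(\<lambda>j. (cmod (a j))\<^sup>2) summable_on range (\<lambda>k. m + int k)"
    using assms unfolding in_l2_def by (rule summable_on_subset_banach) auto
  then have "(\<lambda>k. (cmod (a (m + int k)))\<^sup>2) summable_on UNIV"
    by (subst (asm) summable_on_reindex[OF inj]) (simp add: o_def)
  then have "(\<lambda>k. (cmod (a (m + int k)))\<^sup>2) \<longlonglongrightarrow> 0"
    by (intro summable_LIMSEQ_zero summable_on_imp_summable)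
  then show ?thesis
    by (simp add: tendsto_norm_zero_iff)
qed

text \<open>Split \<open>b\<close> into a finitely supported part, whose correlation is a finite sum
  of terms tending to 0, and a tail that is small in norm, controlled by Cauchy-Schwarz uniformly in
  the lag.\<close>

lemma corr_tendsto_0:
  assumes a: "in_l2 a" and b: "in_l2 b"
  shows "(\<lambda>k. corr a b (j + int k)) \<longlonglongrightarrow> 0"
proof (rule LIMSEQ_I)
  fix e :: real assume e: "0 < e"
  \<comment> \<open>The norm allowed for the tail; the summand 1 keeps the denominator positive when
    \<open>a\<close> is zero.\<close>
  define t where "t = e / (2 * (l2_norm a + 1))"
  have pos: "0 < l2_norm a + 1"
    using l2_norm_nonneg[of a] by linarith
  have t: "0 < t"
    using e pos by (simp add: t_def)
  have at: "l2_norm a * t < e / 2"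
  proof -
    have "l2_norm a * t < (l2_norm a + 1) * t" using t by simp
    also have "\<dots> = e / 2" using pos by (simp add: t_def field_simps)
    finally show ?thesis .
  qed
  have bs: "(\<lambda>m. (cmod (b m))\<^sup>2) summable_on UNIV"
    using b by (simp add: in_l2_def)
  obtain F where F: "finite F"
    "norm (sum (\<lambda>m. (cmod (b m))\<^sup>2) F - (\<Sum>\<^sub>\<infinity>m. (cmod (b m))\<^sup>2)) \<le> t\<^sup>2"
    using infsum_finite_approximation[OF bs, of "t\<^sup>2"] t
    unfolding dist_norm by auto
  define b1 where "b1 = (\<lambda>m. if m \<in> F then b m else 0)"
  define b2 where "b2 = (\<lambda>m. if m \<in> F then 0 else b m)"
  have b2: "in_l2 b2"
    unfolding in_l2_def
    by (rule summable_on_comparison_test[OF bs]) (auto simp: b2_def)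
  have b1: "in_l2 b1"
    unfolding in_l2_def
    by (rule summable_on_comparison_test[OF bs]) (auto simp: b1_def)
  have b2n: "l2_norm b2 \<le> t"
  proof -
    have "(\<Sum>\<^sub>\<infinity>m. (cmod (b2 m))\<^sup>2) = (\<Sum>\<^sub>\<infinity>m\<in>- F. (cmod (b m))\<^sup>2)"
      by (rule infsum_cong_neutral) (auto simp: b2_def)
    also have "\<dots> = (\<Sum>\<^sub>\<infinity>m. (cmod (b m))\<^sup>2) - sum (\<lambda>m. (cmod (b m))\<^sup>2) F"
      using infsum_Diff[OF bs, of F] F(1) by (simp add: Compl_eq_Diff_UNIV)
    also have "\<dots> \<le> t\<^sup>2" using F(2) by simp
    finally show ?thesis
      unfolding l2_norm_def using t by (simp add: real_le_lsqrt infsum_nonneg)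
  qed
  \<comment> \<open>A sum in the form of a difference, so that \<open>corr_diff_right\<close>
    applies.\<close>
  have b_eq: "b = (\<lambda>m. b1 m - (- b2 m))"
    by (auto simp: b1_def b2_def)
  have split: "corr a b k = corr a b1 k + corr a b2 k" for k
    using corr_diff_right[OF b1 in_l2_uminus[OF b2] a, of k]
    unfolding b_eq[symmetric] by (simp add: corr_uminus_right)
  have "corr a b1 k = (\<Sum>m\<in>F. a (m + k) * cnj (b m))" for k
  proof -
    have "corr a b1 k = (\<Sum>\<^sub>\<infinity>m\<in>F. a (m + k) * cnj (b m))"
      unfolding corr_def by (rule infsum_cong_neutral) (auto simp: b1_def)
    then show ?thesis using F(1) by simp
  qed
  moreover have "(\<lambda>k. \<Sum>m\<in>F. a (m + (j + int k)) * cnj (b m)) \<longlonglongrightarrow> (\<Sum>m\<in>F. 0 * cnj (b m))"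
    using in_l2_tendsto_0[OF a, of "_ + j"]
    by (intro tendsto_intros) (simp add: add.assoc)
  ultimately have "(\<lambda>k. corr a b1 (j + int k)) \<longlonglongrightarrow> 0"
    by simp
  then obtain N where N: "\<And>k. k \<ge> N \<Longrightarrow> cmod (corr a b1 (j + int k)) < e / 2"
    using LIMSEQ_D[of _ 0 "e / 2"] e by fastforce
  show "\<exists>N. \<forall>k\<ge>N. norm (corr a b (j + int k) - 0) < e"
  proof (intro exI allI impI)
    fix k assume "N \<le> k"
    have "cmod (corr a b2 (j + int k)) \<le> l2_norm a * l2_norm b2"
      by (rule norm_corr_le[OF a b2])
    also have "\<dots> \<le> l2_norm a * t"
      using b2n by (simp add: mult_left_mono)
    finally have "cmod (corr a b2 (j + int k)) < e / 2"
      using at by simp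
    then show "norm (corr a b (j + int k) - 0) < e"
      using N[OF \<open>N \<le> k\<close>] norm_triangle_ineq[of "corr a b1 (j + int k)" "corr a b2 (j + int k)"]
      by (simp add: split)
  qed
qed

section \<open>Correlations of consecutive rows\<close>

lemma corr_step_left:
  assumes "step a a'" "in_l2 a" "in_l2 a'" "in_l2 c"
  shows "corr a' c (k + 1) + \<i> * corr a' c k = corr a c k + \<i> * corr a c (k + 1)"
proof -
  note s = corr_summable[OF assms(2,4)] corr_summable[OF assms(3,4)]
  have "corr a' c (k + 1) + \<i> * corr a' c k
      = (\<Sum>\<^sub>\<infinity>m. a' (m + (k + 1)) * cnj (c m) + \<i> * (a' (m + k) * cnj (c m)))"
    unfolding corr_def
    by (simp add: infsum_add infsum_cmult_right s summable_on_cmult_right)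
  also have "\<dots> = (\<Sum>\<^sub>\<infinity>m. a (m + k) * cnj (c m) + \<i> * (a (m + (k + 1)) * cnj (c m)))"
  proof (rule infsum_cong)
    fix m
    have "a' (m + k + 1) + \<i> * a' (m + k) = a (m + k) + \<i> * a (m + k + 1)"
      using assms(1) by (simp add: step_def)
    then have "(a' (m + k + 1) + \<i> * a' (m + k)) * cnj (c m)
        = (a (m + k) + \<i> * a (m + k + 1)) * cnj (c m)"
      by simp
    then show "a' (m + (k + 1)) * cnj (c m) + \<i> * (a' (m + k) * cnj (c m))
        = a (m + k) * cnj (c m) + \<i> * (a (m + (k + 1)) * cnj (c m))"
      by (simp add: algebra_simps)
  qed
  also have "\<dots> = corr a c k + \<i> * corr a c (k + 1)"
    unfolding corr_def
    by (simp add: infsum_add infsum_cmult_right s summable_on_cmult_right)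
  finally show ?thesis .
qed

lemma corr_cnj_swap: "cnj (corr a b k) = corr b a (- k)"
proof -
  have "cnj (corr a b k) = (\<Sum>\<^sub>\<infinity>m. b m * cnj (a (m + k)))"
    unfolding corr_def by (simp add: mult.commute flip: infsum_cnj)
  also have "\<dots> = corr b a (- k)"
    unfolding corr_def
    using infsum_reindex_bij_betw[OF bij_add_int, of "\<lambda>m. b (m + - k) * cnj (a m)" k]
    by simp
  finally show ?thesis .
qed

text \<open>Exchanging the arguments conjugates the correlation and negates the lag. Conjugation
  also turns \<open>\<i>\<close> into \<open>- \<i>\<close>, and multiplying by \<open>\<i>\<close>
  restores the recurrence of \<open>corr_step_left\<close>.\<close>

lemma corr_step_right:
  assumes "step c c'" "in_l2 c" "in_l2 c'" "in_l2 a"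
  shows "corr a c' (k + 1) + \<i> * corr a c' k = corr a c k + \<i> * corr a c (k + 1)"
proof -
  have "cnj (corr a c' k) + \<i> * cnj (corr a c' (k + 1))
      = cnj (corr a c (k + 1)) + \<i> * cnj (corr a c k)"
    using corr_step_left[OF assms, of "- k - 1"] by (simp add: corr_cnj_swap)
  from arg_cong[OF this, of cnj]
  have "corr a c' k - \<i> * corr a c' (k + 1) = corr a c (k + 1) - \<i> * corr a c k"
    by simp
  then have "\<i> * (corr a c' k - \<i> * corr a c' (k + 1))
      = \<i> * (corr a c (k + 1) - \<i> * corr a c k)"
    by simp
  then show ?thesis
    by (simp add: algebra_simps)
qed

text \<open>
  The two sides satisfy the same first-order recurrence in the lag, so their difference has
  constant modulus; it vanishes because correlations tend to zero at infinity.
\<close>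

lemma corr_step_swap:
  assumes "step a a'" "step c c'" and l2: "in_l2 a" "in_l2 a'" "in_l2 c" "in_l2 c'"
  shows "corr a' c k = corr a c' k"
proof -
  define d where "d j = corr a' c j - corr a c' j" for j
  have "d (j + 1) = - \<i> * d j" for j
  proof -
    have eq: "corr a' c (j + 1) + \<i> * corr a' c j = corr a c' (j + 1) + \<i> * corr a c' j"
      using corr_step_left[OF assms(1) l2(1,2,3)] corr_step_right[OF assms(2) l2(3,4,1)] by simp
    show ?thesis
      using arg_cong[OF eq, of "\<lambda>x. x - corr a c' (j + 1) - \<i> * corr a' c j"]
      by (simp add: d_def right_diff_distrib)
  qed
  then have const: "cmod (d (j + 1)) = cmod (d j)" for j
    by (simp add: norm_mult)
  have "cmod (d (k + int n)) = cmod (d k)" for n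
  proof (induction n)
    case (Suc n)
    then show ?case
      using const[of "k + int n"] by (simp add: ac_simps)
  qed simp
  moreover have "(\<lambda>n. d (k + int n)) \<longlonglongrightarrow> 0 - 0"
    unfolding d_def by (intro tendsto_diff corr_tendsto_0 l2)
  ultimately have "(\<lambda>n. cmod (d k)) \<longlonglongrightarrow> 0"
    using tendsto_norm_zero[of "\<lambda>n. d (k + int n)" sequentially] by simp
  then show ?thesis
    by (simp add: d_def LIMSEQ_const_iff)
qed

text \<open>The sign change anticommutes with the shift, so it exchanges the two sides of the
  equation and reverses the direction of the step. This is the passage from q to -1/q.\<close>

lemma step_alt: "step c c' \<Longrightarrow> step (alt c') (\<lambda>m. - alt c m)"
  unfolding step_def
proof
  fix m
  assume "\<forall>m. c m + \<i> * c (m + 1) = c' (m + 1) + \<i> * c' m"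
  then have "\<i> * (c m + \<i> * c (m + 1)) = \<i> * (c' (m + 1) + \<i> * c' m)"
    by simp
  then show "alt c' m + \<i> * alt c' (m + 1) = - alt c (m + 1) + \<i> * - alt c m"
    by (auto simp: alt_def algebra_simps)
qed

lemma corr_step_alt:
  assumes "step a a'" "step c c'" "in_l2 a" "in_l2 a'" "in_l2 c" "in_l2 c'"
  shows "corr a' (alt c') k = - corr a (alt c) k"
  using corr_step_swap[OF assms(1) step_alt[OF assms(2)], of k] assms(3-6)
  by (simp add: in_l2_uminus corr_uminus_right)

section \<open>Convexity and decay of the energies of the rows\<close>

lemma convex_bdd_above_decseq:
  fixes E :: "nat \<Rightarrow> real"
  assumes convex: "\<And>n. 0 \<le> E (n + 2) - 2 * E (n + 1) + E n" and bdd: "\<And>n. E n \<le> B"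
  shows "decseq E"
proof (rule decseq_SucI, rule ccontr)
  fix n
  assume "\<not> E (Suc n) \<le> E n"
  then have pos: "0 < E (Suc n) - E n" by simp
  \<comment> \<open>By convexity a positive increment persists, which forces at least linear growth
    and contradicts the bound.\<close>
  have inc: "E (Suc n) - E n \<le> E (Suc (n + k)) - E (n + k)" for k
  proof (induction k)
    case (Suc k)
    then show ?case using convex[of "n + k"] by simp
  qed simp
  have "E n + of_nat k * (E (Suc n) - E n) \<le> E (n + k)" for k
  proof (induction k)
    case (Suc k)
    then show ?case using inc[of k] by (simp add: algebra_simps)
  qed simp
  then have "of_nat k * (E (Suc n) - E n) \<le> B - E n" for k
    using bdd[of "n + k"] by (smt (verit))
  moreover obtain k where "B - E n < of_nat k * (E (Suc n) - E n)"
    using reals_Archimedean3[OF pos] by blast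
  ultimately show False
    using not_less by blast
qed

locale bounded_rows =
  fixes r :: "nat \<Rightarrow> int \<Rightarrow> complex" and B :: real
  assumes step: "step (r n) (r (Suc n))"
    and l2: "in_l2 (r n)"
    and bounded: "l2_norm (r n) \<le> B"
begin

lemma corr_swap: "corr (r (Suc n)) (r m) k = corr (r n) (r (Suc m)) k"
  by (rule corr_step_swap[OF step step]) (rule l2)+

lemma l2_norm_second_difference:
  "(l2_norm (\<lambda>m. r (n + 2) m - r n m))\<^sup>2
    = (l2_norm (r (n + 2)))\<^sup>2 - 2 * (l2_norm (r (n + 1)))\<^sup>2 + (l2_norm (r n))\<^sup>2"
proof -
  let ?d = "\<lambda>m. r (n + 2) m - r n m"
  have "complex_of_real ((l2_norm ?d)\<^sup>2) = corr ?d ?d 0"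
    by (simp add: corr_self_0 in_l2_diff l2)
  also have "\<dots> = corr (r (n + 2)) (r (n + 2)) 0 - corr (r (n + 2)) (r n) 0
      - (corr (r n) (r (n + 2)) 0 - corr (r n) (r n) 0)"
    by (simp add: corr_diff_left corr_diff_right in_l2_diff l2)
  also have "\<dots> = corr (r (n + 2)) (r (n + 2)) 0 - 2 * corr (r (n + 1)) (r (n + 1)) 0
      + corr (r n) (r n) 0"
    \<comment> \<open>Both cross terms equal the energy of the middle row.\<close>
    using corr_swap[of "n + 1" n 0] corr_swap[of n "n + 1" 0] by simp
  also have "\<dots> = complex_of_real
      ((l2_norm (r (n + 2)))\<^sup>2 - 2 * (l2_norm (r (n + 1)))\<^sup>2 + (l2_norm (r n))\<^sup>2)"
    by (simp add: corr_self_0 l2)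
  finally show ?thesis
    by (simp only: of_real_eq_iff)
qed

lemma decseq_energy: "decseq (\<lambda>n. (l2_norm (r n))\<^sup>2)"
proof (rule convex_bdd_above_decseq)
  show "0 \<le> (l2_norm (r (n + 2)))\<^sup>2 - 2 * (l2_norm (r (n + 1)))\<^sup>2 + (l2_norm (r n))\<^sup>2" for n
    unfolding l2_norm_second_difference[symmetric] by simp
  show "(l2_norm (r n))\<^sup>2 \<le> B\<^sup>2" for n
    by (simp add: bounded power_mono)
qed

lemma l2_norm_le_first: "l2_norm (r n) \<le> l2_norm (r 0)"
  using decseqD[OF decseq_energy, of 0 n] by (simp add: power2_le_iff_abs_le)

lemma increment_tendsto_0: "(\<lambda>n. l2_norm (\<lambda>m. r (n + 2) m - r n m)) \<longlonglongrightarrow> 0"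
proof -
  obtain L where L: "(\<lambda>n. (l2_norm (r n))\<^sup>2) \<longlonglongrightarrow> L"
    using decseq_convergent[OF decseq_energy, of 0] by auto
  \<comment> \<open>The second difference of a convergent sequence tends to 0.\<close>
  have "(\<lambda>n. (l2_norm (\<lambda>m. r (n + 2) m - r n m))\<^sup>2) \<longlonglongrightarrow> L - 2 * L + L"
    unfolding l2_norm_second_difference
    by (intro tendsto_intros LIMSEQ_ignore_initial_segment L)
  then show ?thesis
    using tendsto_real_sqrt[of _ "0::real"] by fastforce
qed

lemma corr_alt_add:
  "corr (r (n + j)) (alt (r (m + j))) k = (-1) ^ j * corr (r n) (alt (r m)) k"
proof (induction j)
  case (Suc j)
  then show ?case
    using corr_step_alt[OF step[of "n + j"] step[of "m + j"] l2 l2 l2 l2, of k] by simp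
qed simp

text \<open>Moving both arguments up \<open>j\<close> rows changes the difference \<open>x\<close>
  of the two sides only by a sign. There it is at most the norm of an increment times
  \<open>B\<close>, which tends to 0.\<close>

lemma corr_alt_two_rows: "corr (r (n + 2)) (alt (r n)) k = corr (r n) (alt (r n)) k"
proof -
  define x where "x = corr (r (n + 2)) (alt (r n)) k - corr (r n) (alt (r n)) k"
  have "cmod x \<le> l2_norm (\<lambda>m. r (j + n + 2) m - r (j + n) m) * B" for j
  proof -
    have "corr (\<lambda>m. r (j + n + 2) m - r (j + n) m) (alt (r (j + n))) k = (-1) ^ j * x"
      using corr_alt_add[of "n + 2" j n k] corr_alt_add[of n j n k]
      by (simp add: corr_diff_left l2 x_def right_diff_distrib ac_simps)
    then have "cmod x = cmod (corr (\<lambda>m. r (j + n + 2) m - r (j + n) m) (alt (r (j + n))) k)"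
      by (simp add: norm_mult norm_power)
    also have "\<dots> \<le> l2_norm (\<lambda>m. r (j + n + 2) m - r (j + n) m) * l2_norm (r (j + n))"
      using norm_corr_le[of "\<lambda>m. r (j + n + 2) m - r (j + n) m" "alt (r (j + n))" k]
      by (simp add: in_l2_diff l2)
    also have "\<dots> \<le> l2_norm (\<lambda>m. r (j + n + 2) m - r (j + n) m) * B"
      by (simp add: bounded mult_left_mono)
    finally show ?thesis .
  qed
  moreover have "(\<lambda>j. l2_norm (\<lambda>m. r (j + n + 2) m - r (j + n) m) * B) \<longlonglongrightarrow> 0 * B"
    by (intro tendsto_mult_right LIMSEQ_ignore_initial_segment[OF increment_tendsto_0])
  ultimately have "cmod x \<le> 0 * B"
    using LIMSEQ_le_const by blast
  then show ?thesis
    by (simp add: x_def)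
qed

lemma corr_alt_periodic: "corr (r n) (alt (r n)) (k + 2) = corr (r n) (alt (r n)) k"
proof -
  define R R1 where "R = corr (r n) (alt (r n))" and "R1 = corr (r (Suc n)) (alt (r n))"
  have 1: "R1 (j + 1) + \<i> * R1 j = R j + \<i> * R (j + 1)" for j
    unfolding R_def R1_def by (intro corr_step_left step) (simp_all add: l2)
  \<comment> \<open>The equation for the next pair of rows; \<open>corr_alt_two_rows\<close> puts
    row \<open>n\<close> in place of row \<open>n + 2\<close>.\<close>
  have 2: "R (j + 1) + \<i> * R j = R1 j + \<i> * R1 (j + 1)" for j
    using corr_step_left[OF step[of "Suc n"] l2 l2, of "alt (r n)" j] corr_alt_two_rows[of n]
    by (simp add: l2 R_def R1_def)
  \<comment> \<open>Multiply \<open>2\<close> by \<open>- \<i>\<close> and subtract it from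
    \<open>1\<close>.\<close>
  have R1: "R1 j = R (j + 1)" for j
    using 1[of j] 2[of j] by (simp add: complex_eq_iff)
  show ?thesis
    using 1[of k] by (simp add: R1 R_def add.assoc)
qed

text \<open>The even lags form a constant sequence by periodicity, and it tends to 0.\<close>

lemma corr_alt_0: "corr (r n) (alt (r n)) 0 = 0"
proof -
  have "corr (r n) (alt (r n)) (int (2 * j)) = corr (r n) (alt (r n)) 0" for j
  proof (induction j)
    case (Suc j)
    then show ?case
      using corr_alt_periodic[of n "int (2 * j)"] by (simp add: add.commute)
  qed simp
  moreover have "(\<lambda>j. corr (r n) (alt (r n)) (0 + int j)) \<longlonglongrightarrow> 0"
    by (intro corr_tendsto_0) (simp_all add: l2)
  then have "(\<lambda>j. corr (r n) (alt (r n)) (int (2 * j))) \<longlonglongrightarrow> 0"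
    using LIMSEQ_subseq_LIMSEQ[of _ 0 "\<lambda>j. 2 * j"] by (force simp: o_def strict_mono_def)
  ultimately show ?thesis
    by (simp add: LIMSEQ_const_iff)
qed

end

section \<open>Even and odd sites, and sampling\<close>

lemma even_odd_sums:
  assumes a: "in_l2 a" and zero: "corr a (alt a) 0 = 0"
  shows "(\<Sum>\<^sub>\<infinity>m. (cmod (a (2 * m)))\<^sup>2) = (l2_norm a)\<^sup>2 / 2"
    and "(\<Sum>\<^sub>\<infinity>m. (cmod (a (2 * m + 1)))\<^sup>2) = (l2_norm a)\<^sup>2 / 2"
proof -
  let ?g = "\<lambda>m. (cmod (a m))\<^sup>2"
  \<comment> \<open>The summand of \<open>corr a (alt a) 0\<close>, which is real: its sum is the
    even energy minus the odd energy, while the sum of \<open>?g\<close> is their total.\<close>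
  let ?h = "\<lambda>m. if even m then ?g m else - ?g m"
  let ?E = "range (\<lambda>m::int. 2 * m)" and ?O = "range (\<lambda>m::int. 2 * m + 1)"
  have inj: "inj (\<lambda>m::int. 2 * m)" "inj (\<lambda>m::int. 2 * m + 1)"
    by (auto intro: injI)
  have U: "UNIV = ?E \<union> ?O"
    by (auto elim: evenE oddE) (metis evenE oddE rangeI)
  have disj: "?E \<inter> ?O = {}"
    by (auto, presburger)
  have g: "?g summable_on S" for S
    using a unfolding in_l2_def by (rule summable_on_subset_banach) simp
  have E: "infsum ?g ?E = (\<Sum>\<^sub>\<infinity>m. ?g (2 * m))" and O: "infsum ?g ?O = (\<Sum>\<^sub>\<infinity>m. ?g (2 * m + 1))"
    by (simp_all add: infsum_reindex inj o_def)
  have total: "(l2_norm a)\<^sup>2 = infsum ?g ?E + infsum ?g ?O"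
    unfolding l2_norm_power2 by (subst U, rule infsum_Un_disjoint[OF g g disj])
  have "?h summable_on ?E \<longleftrightarrow> ?g summable_on ?E"
    by (rule summable_on_cong) auto
  then have hE: "?h summable_on ?E" "infsum ?h ?E = infsum ?g ?E"
    using g[of ?E] by (auto intro!: infsum_cong)
  have "?h summable_on ?O \<longleftrightarrow> (\<lambda>m. - ?g m) summable_on ?O"
    by (rule summable_on_cong) auto
  then have hO: "?h summable_on ?O" "infsum ?h ?O = - infsum ?g ?O"
    using g[of ?O]
    by (auto simp: summable_on_uminus simp flip: infsum_uminus intro!: infsum_cong)
  have h: "?h summable_on UNIV"
    by (subst U, rule summable_on_Un_disjoint[OF hE(1) hO(1) disj])
  have "corr a (alt a) 0 = (\<Sum>\<^sub>\<infinity>m. complex_of_real (?h m))"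
    unfolding corr_def by (rule infsum_cong) (simp add: alt_def complex_norm_square del: of_real_power)
  also have "\<dots> = of_real (infsum ?h UNIV)"
    by (rule infsum_of_real[OF h])
  finally have "infsum ?h UNIV = 0"
    using zero by simp
  moreover have "infsum ?h UNIV = infsum ?g ?E - infsum ?g ?O"
    by (subst U, subst infsum_Un_disjoint[OF hE(1) hO(1) disj]) (simp add: hE hO)
  ultimately show "(\<Sum>\<^sub>\<infinity>m. ?g (2 * m)) = (l2_norm a)\<^sup>2 / 2" "(\<Sum>\<^sub>\<infinity>m. ?g (2 * m + 1)) = (l2_norm a)\<^sup>2 / 2"
    using total unfolding E O by simp_all
qed

lemma step_row:
  assumes "f \<in> Hol"
  shows "step (row f n) (row f (Suc n))"
  unfolding step_def
proof
  fix m
  let ?z = "of_int m + \<i> * of_nat n"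
  have "?z \<in> Z2_plus"
    unfolding Z2_plus_def by (intro CollectI exI[of _ m] exI[of _ "int n"]) simp
  then have "f ?z + \<i> * f (?z + 1) - f (?z + 1 + \<i>) - \<i> * f (?z + \<i>) = 0"
    using assms by (simp add: Hol_def)
  then show "row f n m + \<i> * row f n (m + 1) = row f (Suc n) (m + 1) + \<i> * row f (Suc n) m"
    by (simp add: row_def algebra_simps)
qed

lemma
  assumes f: "f \<in> H2"
  shows H2_norm_eq: "H2_norm f = l2_norm (row f 0)"
    and row_in_l2: "in_l2 (row f n)"
    and row_corr_alt: "corr (row f n) (alt (row f n)) 0 = 0"
proof -
  obtain B where B: "\<And>n. l2_norm (row f n) \<le> B"
    using f unfolding H2_def bdd_above_def by auto
  interpret bounded_rows "row f" B
    using f B by unfold_locales (auto simp: H2_def step_row)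
  show "H2_norm f = l2_norm (row f 0)"
    \<comment> \<open>The energies decrease, so the supremum is attained at row 0.\<close>
    unfolding H2_norm_def by (rule cSup_eq_maximum) (auto simp: l2_norm_le_first)
  show "in_l2 (row f n)" by (rule l2)
  show "corr (row f n) (alt (row f n)) 0 = 0" by (rule corr_alt_0)
qed

text \<open>Covers the even and the odd sites at once; injectivity of \<open>g\<close> turns the sum
  over the set of points into a sum over the index.\<close>

lemma sampling_set_rangeI:
  fixes g :: "int \<Rightarrow> int"
  assumes "inj g" and half: "\<And>f. f \<in> H2 \<Longrightarrow> (\<Sum>\<^sub>\<infinity>m. (cmod (row f 0 (g m)))\<^sup>2) = (l2_norm (row f 0))\<^sup>2 / 2"
  shows "sampling_set {of_int (g m) | m. True}"
proof -
  let ?p = "\<lambda>m. complex_of_int (g m)"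
  have inj: "inj ?p"
    using \<open>inj g\<close> by (auto simp: inj_def)
  have eq: "{of_int (g m) | m. True} = range ?p"
    by auto
  have sub: "range ?p \<subseteq> Z2_plus"
  proof (rule image_subsetI)
    show "?p m \<in> Z2_plus" for m
      unfolding Z2_plus_def by (intro CollectI exI[of _ "g m"] exI[of _ 0]) simp
  qed
  have "(\<lambda>z. (cmod (f z))\<^sup>2) summable_on range ?p" if "f \<in> H2" for f
  proof -
    have "(\<lambda>m. (cmod (row f 0 m))\<^sup>2) summable_on range g"
      using row_in_l2[OF that, of 0] unfolding in_l2_def by (rule summable_on_subset_banach) simp
    then show ?thesis
      using \<open>inj g\<close> inj by (simp add: summable_on_reindex o_def row_def)
  qed
  moreover have "(\<Sum>\<^sub>\<infinity>z\<in>range ?p. (cmod (f z))\<^sup>2) = 1 / 2 * (H2_norm f)\<^sup>2" if "f \<in> H2" for f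
    using half[OF that] by (simp add: infsum_reindex[OF inj] o_def row_def H2_norm_eq[OF that])
  ultimately show ?thesis
    unfolding sampling_set_def eq using sub
    \<comment> \<open>The sum is exactly half the squared norm, so both constants are 1/2.\<close>
    by (intro conjI exI[of _ "1/2::real"]) auto
qed

theorem proposition7p2:
  shows "(\<forall>f\<in>H2.
      (\<forall>n::nat.
         (\<Sum>\<^sub>\<infinity>m::int. (cmod (f (of_int (2 * m) + \<i> * of_nat n)))\<^sup>2)
           = (\<Sum>\<^sub>\<infinity>m::int. (cmod (f (of_int (2 * m + 1) + \<i> * of_nat n)))\<^sup>2) \<and>
         (\<Sum>\<^sub>\<infinity>m::int. (cmod (f (of_int (2 * m + 1) + \<i> * of_nat n)))\<^sup>2)
           = 1 / 2 * (\<Sum>\<^sub>\<infinity>m::int. (cmod (f (of_int m + \<i> * of_nat n)))\<^sup>2)) \<and>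
      (\<Sum>\<^sub>\<infinity>m::int. (cmod (f (of_int (2 * m))))\<^sup>2)
        = (\<Sum>\<^sub>\<infinity>m::int. (cmod (f (of_int (2 * m + 1))))\<^sup>2) \<and>
      (\<Sum>\<^sub>\<infinity>m::int. (cmod (f (of_int (2 * m + 1))))\<^sup>2) = 1 / 2 * (H2_norm f)\<^sup>2) \<and>
    sampling_set Lambda0_even \<and> sampling_set Lambda0_odd"
proof -
  have half: "(\<Sum>\<^sub>\<infinity>m. (cmod (row f n (2 * m)))\<^sup>2) = (l2_norm (row f n))\<^sup>2 / 2"
    "(\<Sum>\<^sub>\<infinity>m. (cmod (row f n (2 * m + 1)))\<^sup>2) = (l2_norm (row f n))\<^sup>2 / 2" if "f \<in> H2" for f n
    by (intro even_odd_sums row_in_l2 row_corr_alt that)+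
  have "sampling_set Lambda0_even"
    unfolding Lambda0_even_def by (rule sampling_set_rangeI) (auto intro: injI simp: half)
  moreover have "sampling_set Lambda0_odd"
    unfolding Lambda0_odd_def by (rule sampling_set_rangeI) (auto intro: injI simp: half)
  moreover have sums:
    "(\<Sum>\<^sub>\<infinity>m::int. (cmod (f (of_int (2 * m) + \<i> * of_nat n)))\<^sup>2)
      = 1 / 2 * (\<Sum>\<^sub>\<infinity>m::int. (cmod (f (of_int m + \<i> * of_nat n)))\<^sup>2)"
    "(\<Sum>\<^sub>\<infinity>m::int. (cmod (f (of_int (2 * m + 1) + \<i> * of_nat n)))\<^sup>2)
      = 1 / 2 * (\<Sum>\<^sub>\<infinity>m::int. (cmod (f (of_int m + \<i> * of_nat n)))\<^sup>2)"
    "(\<Sum>\<^sub>\<infinity>m::int. (cmod (f (of_int (2 * m))))\<^sup>2) = 1 / 2 * (H2_norm f)\<^sup>2"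
    "(\<Sum>\<^sub>\<infinity>m::int. (cmod (f (of_int (2 * m + 1))))\<^sup>2) = 1 / 2 * (H2_norm f)\<^sup>2"
    if "f \<in> H2" for f n
    using half[OF that, of n] half[OF that, of 0]
    by (simp_all add: row_def l2_norm_power2 H2_norm_eq[OF that])
  ultimately show ?thesis
    by (intro conjI ballI allI) (simp_all only: sums)
qed

end
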